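(* Let $\mathcal{H}$ be a complex Hilbert space and let $L, M$ be closed linear subspaces of $\mathcal{H}$ such that, with $Q = L\cap M$, both $L\ominus Q$ and $M\ominus Q$ are non-zero. Suppose that 1. $c = c(L,M) < 1$; 2. $(L+M)^\perp = \{0\}$, where $(L+M)^\perp$ is the orthogonal complement of $L+M$ in $\mathcal{H}$. Then there exist constants $a_1,a_2$ (independent of $x$) with $0\le a_k\le 1$ ($k=1,2$), and with $a_1=a_2=0$ if $L\cap M=\{0\}$, such that every vector $x\in\mathcal{H}$ can be represented as $$x = x^L + x^M,\qquad x^L\in L,\ x^M\in M,$$ with $$\|x^L\|\le A_1\|x\|,\qquad \|x^M\|\le A_2\|x\|,$$ where $$A_1 = a_1+\frac{1}{\sqrt{1-c^2}},\qquad A_2 = a_2+\frac{1}{\sqrt{1-c^2}}.$$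
   Context: For closed subspaces $L,M$ of a Hilbert space $\mathcal{H}$ with $Q=L\cap M$, $L\ominus Q$ and $M\ominus Q$ denote the orthogonal complements of $Q$ in $L$ and in $M$ respectively. The case $Q=\{0\}$ is allowed; it is assumed that $L\ominus Q\neq\{0\}$ and $M\ominus Q\ne\{0\}$ (equivalently, neither of $L$, $M$ contains the other). The inclination of $L$ and $M$ is $$c(L,M)=\sup\left\{\frac{|(u,v)|}{\|u\|\,\|v\|} : 0\ne u\in L\ominus Q,\ 0\neq v\in M\ominus Q\right\}\in[0,1].$$ The sum is $L+M=\{x\in\mathcal{H}: x=x^L+x^M,\ x^L\in L,\ x^M\in M\}$. *)

theory Defs
  imports Complex_Main "HOL-Library.Set_Algebras"
begin

class scaleC =
  fixes scaleC :: "complex \<Rightarrow> 'a \<Rightarrow> 'a" (infixr "*\<^sub>C" 75)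

text \<open>The real scalar multiplication inherited from \<^class>\<open>real_normed_vector\<close> is the restriction
  of the complex one, and the norm is the one induced by the inner product. The inner product
  is linear in its first argument and conjugate-linear in its second.\<close>

class complex_inner = real_normed_vector + scaleC +
  fixes cinner :: "'a \<Rightarrow> 'a \<Rightarrow> complex"
  assumes scaleC_add_right: "a *\<^sub>C (x + y) = a *\<^sub>C x + a *\<^sub>C y"
    and scaleC_add_left: "(a + b) *\<^sub>C x = a *\<^sub>C x + b *\<^sub>C x"
    and scaleC_scaleC: "a *\<^sub>C (b *\<^sub>C x) = (a * b) *\<^sub>C x"
    and scaleC_one: "1 *\<^sub>C x = x"
    and scaleR_scaleC: "r *\<^sub>R x = complex_of_real r *\<^sub>C x"
    and cinner_commute: "cinner x y = cnj (cinner y x)"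
    and cinner_add_left: "cinner (x + y) z = cinner x z + cinner y z"
    and cinner_scaleC_left: "cinner (a *\<^sub>C x) y = a * cinner x y"
    and cinner_self: "cinner x x = complex_of_real ((norm x)\<^sup>2)"

class chilbert_space = complex_inner + complete_space

instantiation complex :: chilbert_space
begin

definition scaleC_complex :: "complex \<Rightarrow> complex \<Rightarrow> complex"
  where "scaleC_complex a x = a * x"

definition cinner_complex :: "complex \<Rightarrow> complex \<Rightarrow> complex"
  where "cinner_complex x y = x * cnj y"

instance
  by standard
    (auto simp: scaleC_complex_def cinner_complex_def algebra_simps scaleR_conv_of_real
      complex_norm_square simp del: of_real_power)

end

global_interpretation complex_space: vector_space "scaleC :: complex \<Rightarrow> 'a \<Rightarrow> 'a::complex_inner"
  defines csubspace = complex_space.subspace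
  by standard (simp_all add: scaleC_add_right scaleC_add_left scaleC_scaleC scaleC_one)

definition ortho_complement :: "'a::complex_inner set \<Rightarrow> 'a set"
  where "ortho_complement S = {x. \<forall>y\<in>S. cinner x y = 0}"

definition ominus :: "'a::complex_inner set \<Rightarrow> 'a set \<Rightarrow> 'a set" (infixl "\<ominus>" 65)
  where "L \<ominus> Q = L \<inter> ortho_complement Q"

text \<open>The real supremum below is meaningful only if both \<open>L \<ominus> (L \<inter> M)\<close> and \<open>M \<ominus> (L \<inter> M)\<close>
  contain non-zero vectors; otherwise the set is empty.\<close>

definition inclination :: "'a::complex_inner set \<Rightarrow> 'a set \<Rightarrow> real"
  where "inclination L M =
    Sup {cmod (cinner u v) / (norm u * norm v) | u v.
      u \<in> L \<ominus> (L \<inter> M) \<and> u \<noteq> 0 \<and> v \<in> M \<ominus> (L \<inter> M) \<and> v \<noteq> 0}"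

end

theory Submission
  imports Defs "HOL-Analysis.Elementary_Topology"
begin

text \<open>The cosine bound \<open>|(u, v)| \<le> c \<parallel>u\<parallel> \<parallel>v\<parallel>\<close> on \<open>L \<ominus> Q\<close> and \<open>M \<ominus> Q\<close> gives
  \<open>(1 - c\<^sup>2) \<parallel>v\<parallel>\<^sup>2 \<le> \<parallel>u + v\<parallel>\<^sup>2\<close> by completing the square, and adding a vector of \<open>Q\<close>
  only enlarges the right-hand side. Hence the \<open>M \<ominus> Q\<close>-component depends boundedly on the sum,
  which makes \<open>L + M = L + (M \<ominus> Q)\<close> closed. Being also dense, it is the whole space. Placing the
  \<open>Q\<close>-component of \<open>x\<close> in \<open>x\<^sup>L\<close> costs at most \<open>\<parallel>x\<parallel>\<close> there and nothing in \<open>x\<^sup>M\<close>, so that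
  \<open>a\<^sub>2 = 0\<close> always works.\<close>

section \<open>Inner product identities and the Cauchy-Schwarz inequality\<close>

lemma cinner_add_right: "cinner x (y + z) = cinner x y + cinner x z"
  by (metis cinner_add_left cinner_commute complex_cnj_add)

lemma cinner_scaleC_right: "cinner x (a *\<^sub>C y) = cnj a * cinner x y"
  by (metis cinner_commute cinner_scaleC_left complex_cnj_mult)

lemma cinner_zero_left [simp]: "cinner 0 x = 0"
  using cinner_add_left[of 0 0 x] by simp

lemma cinner_zero_right [simp]: "cinner x 0 = 0"
  using cinner_commute[of x 0] by simp

lemma cinner_minus_right: "cinner x (- y) = - cinner x y"
  using cinner_add_right[of x y "- y"] by (simp add: eq_neg_iff_add_eq_0 add.commute)

lemma norm_add_sq: "(norm (x + y))\<^sup>2 = (norm x)\<^sup>2 + (norm y)\<^sup>2 + 2 * Re (cinner x y)"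
  for x y :: "'a::complex_inner"
proof -
  have "complex_of_real ((norm (x + y))\<^sup>2) =
      complex_of_real ((norm x)\<^sup>2) + complex_of_real ((norm y)\<^sup>2) + (cinner x y + cnj (cinner x y))"
    unfolding cinner_self[symmetric] cinner_commute[of y x, symmetric]
    by (simp add: cinner_add_left cinner_add_right)
  then have "Re (complex_of_real ((norm (x + y))\<^sup>2)) =
      Re (complex_of_real ((norm x)\<^sup>2) + complex_of_real ((norm y)\<^sup>2) + (cinner x y + cnj (cinner x y)))"
    by (rule arg_cong)
  then show ?thesis
    by (simp del: of_real_power)
qed

lemma parallelogram_law:
  "(norm (x + y))\<^sup>2 + (norm (x - y))\<^sup>2 = 2 * (norm x)\<^sup>2 + 2 * (norm y)\<^sup>2"
  for x y :: "'a::complex_inner"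
  using norm_add_sq[of x y] norm_add_sq[of x "- y"] by (simp add: cinner_minus_right)

text \<open>The subtracted vector is the orthogonal projection of \<open>w\<close> onto the line
  spanned by \<open>y\<close>, so this is Pythagoras. Nonnegativity of the left side yields
  Cauchy-Schwarz, and the explicit loss of length drives the variational argument for closest
  points.\<close>

lemma norm_sq_minus_component:
  fixes w y :: "'a::complex_inner"
  assumes "y \<noteq> 0"
  shows "(norm (w - (cinner w y / (norm y)\<^sup>2) *\<^sub>C y))\<^sup>2 = (norm w)\<^sup>2 - (cmod (cinner w y))\<^sup>2 / (norm y)\<^sup>2"
proof -
  define b where "b = cinner w y"
  define r where "r = (norm y)\<^sup>2"
  have r: "r > 0"
    using assms by (simp add: r_def)
  have sq: "(norm ((b / r) *\<^sub>C y))\<^sup>2 = (cmod b)\<^sup>2 / r"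
  proof -
    have "complex_of_real ((norm ((b / r) *\<^sub>C y))\<^sup>2) = (b / r) * cnj (b / r) * complex_of_real r"
      by (simp only: cinner_self[symmetric] cinner_scaleC_left cinner_scaleC_right mult_ac r_def)
    also have "\<dots> = complex_of_real ((cmod b)\<^sup>2 / r)"
      using r by (simp del: of_real_power add: of_real_divide complex_norm_square)
    finally show ?thesis
      by (simp only: of_real_eq_iff)
  qed
  have "cinner w (- ((b / r) *\<^sub>C y)) = - complex_of_real ((cmod b)\<^sup>2 / r)"
    by (simp add: cinner_minus_right cinner_scaleC_right b_def[symmetric] of_real_divide
        complex_norm_square mult.commute del: of_real_power)
  then have "Re (cinner w (- ((b / r) *\<^sub>C y))) = - ((cmod b)\<^sup>2 / r)"
    by (simp only: uminus_complex.sel Re_complex_of_real)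
  then show ?thesis
    using norm_add_sq[of w "- ((b / r) *\<^sub>C y)"] sq by (simp add: b_def r_def)
qed

lemma cinner_Cauchy_Schwarz: "cmod (cinner x y) \<le> norm x * norm y"
  for x y :: "'a::complex_inner"
proof (cases "y = 0")
  case False
  have "0 \<le> (norm x)\<^sup>2 - (cmod (cinner x y))\<^sup>2 / (norm y)\<^sup>2"
    by (simp flip: norm_sq_minus_component[OF False])
  then have "(cmod (cinner x y))\<^sup>2 \<le> (norm x * norm y)\<^sup>2"
    using False by (simp add: field_simps)
  then show ?thesis
    by (rule power2_le_imp_le) simp
qed simp

section \<open>Orthogonal projection onto a closed subspace\<close>

lemma csubspace_scaleR: "csubspace S \<Longrightarrow> x \<in> S \<Longrightarrow> r *\<^sub>R x \<in> S"
  by (simp add: scaleR_scaleC complex_space.subspace_scale)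

text \<open>If \<open>x - p\<close> had a nonzero inner product with some \<open>y\<close> in
  \<open>S\<close>, shifting \<open>p\<close> by the component of \<open>x - p\<close> along
  \<open>y\<close> would stay in \<open>S\<close> and be strictly closer to
  \<open>x\<close>.\<close>

lemma minimizer_diff_orthogonal:
  fixes S :: "'a::complex_inner set"
  assumes S: "csubspace S" and p: "p \<in> S" and min: "\<And>s. s \<in> S \<Longrightarrow> norm (x - p) \<le> norm (x - s)"
  shows "x - p \<in> ortho_complement S"
  unfolding ortho_complement_def
proof (intro CollectI ballI)
  fix y assume y: "y \<in> S"
  show "cinner (x - p) y = 0"
  proof (cases "y = 0")
    case False
    define t where "t = cinner (x - p) y / (norm y)\<^sup>2"
    have "p + t *\<^sub>C y \<in> S"
      using S p y by (simp add: complex_space.subspace_add complex_space.subspace_scale)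
    from min[OF this] have "(norm (x - p))\<^sup>2 \<le> (norm (x - p - t *\<^sub>C y))\<^sup>2"
      by (simp add: algebra_simps)
    then have "(cmod (cinner (x - p) y))\<^sup>2 / (norm y)\<^sup>2 \<le> 0"
      unfolding t_def norm_sq_minus_component[OF False] by linarith
    then show ?thesis
      using False by (simp add: divide_le_0_iff)
  qed simp
qed

text \<open>A minimizing sequence is Cauchy by the parallelogram law, because midpoints of its terms
  stay in \<open>S\<close>. Completeness gives a limit, and closedness keeps it in
  \<open>S\<close>.\<close>

lemma closest_point_exists:
  fixes S :: "'a::chilbert_space set"
  assumes S: "csubspace S" and "closed S"
  obtains p where "p \<in> S" "\<And>s. s \<in> S \<Longrightarrow> norm (x - p) \<le> norm (x - s)"
proof -
  \<comment> \<open>Squared distances are minimized, so that the parallelogram law applies without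
    taking roots.\<close>
  define d where "d = (INF s\<in>S. (norm (x - s))\<^sup>2)"
  have ne: "S \<noteq> {}"
    using complex_space.subspace_0[OF S] by blast
  have bdd: "bdd_below ((\<lambda>s. (norm (x - s))\<^sup>2) ` S)"
    by (rule bdd_belowI2[where m = 0]) simp
  have d_le: "d \<le> (norm (x - s))\<^sup>2" if "s \<in> S" for s
    unfolding d_def using bdd that by (rule cINF_lower)
  have "\<exists>s\<in>S. (norm (x - s))\<^sup>2 < d + inverse (real (Suc n))" for n
    using cINF_less_iff[OF ne bdd, of "d + inverse (real (Suc n))"] by (simp add: d_def)
  then obtain s where sS: "\<And>n. s n \<in> S"
    and s: "\<And>n. (norm (x - s n))\<^sup>2 < d + inverse (real (Suc n))"
    by metis
  have diff: "(norm (s n - s m))\<^sup>2 \<le> 2 * inverse (real (Suc n)) + 2 * inverse (real (Suc m))" for m n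
  proof -
    \<comment> \<open>The midpoint competes in the infimum, which bounds the sum term of the
      parallelogram law below by \<open>4 * d\<close>; only the two excesses over \<open>d\<close>
      are left for the difference term.\<close>
    have "(1/2) *\<^sub>R (s n + s m) \<in> S"
      using S sS by (simp add: csubspace_scaleR complex_space.subspace_add)
    from d_le[OF this] have "d \<le> (norm ((1/2) *\<^sub>R ((x - s n) + (x - s m))))\<^sup>2"
      by (simp add: algebra_simps flip: scaleR_add_left)
    then have "4 * d \<le> (norm ((x - s n) + (x - s m)))\<^sup>2"
      by (simp add: power_divide)
    then show ?thesis
      using parallelogram_law[of "x - s n" "x - s m"] s[of n] s[of m]
      by (simp add: norm_minus_commute)
  qed
  have "Cauchy s"
  proof (rule CauchyI)
    fix e :: real assume e: "e > 0"
    \<comment> \<open>Beyond \<open>N\<close>, \<open>diff\<close> bounds the squared distance by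
      four times \<open>inverse (real (Suc N))\<close>, hence the factor 4.\<close>
    then obtain N where N: "inverse (real (Suc N)) < e\<^sup>2 / 4"
      using reals_Archimedean[of "e\<^sup>2 / 4"] by auto
    have "norm (s m - s n) < e" if "m \<ge> N" "n \<ge> N" for m n
    proof (rule power2_less_imp_less)
      have "inverse (real (Suc m)) \<le> inverse (real (Suc N))"
        "inverse (real (Suc n)) \<le> inverse (real (Suc N))"
        using that by (simp_all add: le_imp_inverse_le)
      then show "(norm (s m - s n))\<^sup>2 < e\<^sup>2"
        using diff[of m n] N by linarith
    qed (use e in simp)
    then show "\<exists>M. \<forall>m\<ge>M. \<forall>n\<ge>M. norm (s m - s n) < e"
      by blast
  qed
  then obtain p where p: "s \<longlonglongrightarrow> p"
    using Cauchy_convergent convergent_def by blast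
  have "(\<lambda>n. (norm (x - s n))\<^sup>2) \<longlonglongrightarrow> (norm (x - p))\<^sup>2"
    by (intro tendsto_intros p)
  moreover have "(\<lambda>n. d + inverse (real (Suc n))) \<longlonglongrightarrow> d + 0"
    by (intro tendsto_intros LIMSEQ_inverse_real_of_nat)
  ultimately have "(norm (x - p))\<^sup>2 \<le> d + 0"
    by (rule LIMSEQ_le) (use s less_imp_le in blast)
  show thesis
  proof
    show "p \<in> S"
      using \<open>closed S\<close> sS p by (metis closed_sequentially)
    show "norm (x - p) \<le> norm (x - t)" if "t \<in> S" for t
    proof (rule power2_le_imp_le)
      show "(norm (x - p))\<^sup>2 \<le> (norm (x - t))\<^sup>2"
        using \<open>(norm (x - p))\<^sup>2 \<le> d + 0\<close> d_le[OF that] by linarith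
    qed simp
  qed
qed

lemma orthogonal_projection_exists:
  fixes S :: "'a::chilbert_space set"
  assumes "csubspace S" and "closed S"
  obtains p where "p \<in> S" "x - p \<in> ortho_complement S"
  using closest_point_exists[OF assms, of x] minimizer_diff_orthogonal[OF assms(1)] by metis

lemma ominus_decomposition:
  fixes L Q :: "'a::chilbert_space set"
  assumes "csubspace L" "csubspace Q" "closed Q" "Q \<subseteq> L" "x \<in> L"
  obtains q u where "q \<in> Q" "u \<in> L \<ominus> Q" "x = q + u"
proof -
  obtain q where "q \<in> Q" "x - q \<in> ortho_complement Q"
    using orthogonal_projection_exists[OF assms(2,3)] by blast
  moreover have "x - q \<in> L"
    using \<open>q \<in> Q\<close> assms by (intro complex_space.subspace_diff) auto
  ultimately show thesis
    using that[of q "x - q"] by (simp add: ominus_def)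
qed

section \<open>Orthogonal complements and the inclination\<close>

lemma csubspace_ortho_complement: "csubspace (ortho_complement S)"
  unfolding complex_space.subspace_def
  by (auto simp: ortho_complement_def cinner_add_left cinner_scaleC_left)

lemma csubspace_ominus: "csubspace L \<Longrightarrow> csubspace (L \<ominus> Q)"
  unfolding ominus_def by (intro complex_space.subspace_inter csubspace_ortho_complement)

lemma bdd_above_inclination:
  "bdd_above {cmod (cinner u v) / (norm u * norm v) | u v.
      u \<in> L \<ominus> (L \<inter> M) \<and> u \<noteq> 0 \<and> v \<in> M \<ominus> (L \<inter> M) \<and> v \<noteq> 0}"
  by (rule bdd_aboveI[where M = 1]) (auto simp: divide_le_eq_1 cinner_Cauchy_Schwarz)

text \<open>The supremum ranges over nonzero vectors only. By Cauchy-Schwarz it is over a bounded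
  set, so each quotient lies below it; if a vector is zero, both sides vanish.\<close>

lemma cinner_le_inclination:
  assumes "u \<in> L \<ominus> (L \<inter> M)" "v \<in> M \<ominus> (L \<inter> M)"
  shows "cmod (cinner u v) \<le> inclination L M * norm u * norm v"
proof (cases "u = 0 \<or> v = 0")
  case False
  then have "cmod (cinner u v) / (norm u * norm v) \<le> inclination L M"
    unfolding inclination_def using assms by (intro cSup_upper bdd_above_inclination) blast
  then show ?thesis
    using False by (simp add: pos_divide_le_eq mult.assoc)
qed auto

text \<open>Nonzero vectors in both complements provide an actual quotient below the supremum.
  Together with \<open>inclination L M < 1\<close> this bounds the square below 1, so the square
  root in the constants is positive.\<close>

lemma inclination_nonneg:
  assumes "csubspace L" "csubspace M" "L \<ominus> (L \<inter> M) \<noteq> {0}" "M \<ominus> (L \<inter> M) \<noteq> {0}"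
  shows "0 \<le> inclination L M"
proof -
  have "0 \<in> L \<ominus> (L \<inter> M)" "0 \<in> M \<ominus> (L \<inter> M)"
    using assms by (auto intro: complex_space.subspace_0 csubspace_ominus)
  then obtain u v where "u \<in> L \<ominus> (L \<inter> M)" "u \<noteq> 0" "v \<in> M \<ominus> (L \<inter> M)" "v \<noteq> 0"
    using assms(3,4) by blast
  then have "0 \<le> inclination L M * (norm u * norm v)" "0 < norm u * norm v"
    using cinner_le_inclination[of u L M v] norm_ge_zero[of "cinner u v"]
    by (simp_all add: mult.assoc del: norm_ge_zero)
  then show ?thesis
    by (simp add: zero_le_mult_iff)
qed

section \<open>Bounds on the components of a sum\<close>

lemma norm_add_sq_cosine_bound:
  fixes u v :: "'a::complex_inner"
  assumes "cmod (cinner u v) \<le> c * norm u * norm v"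
  shows "(1 - c\<^sup>2) * (norm u)\<^sup>2 \<le> (norm (u + v))\<^sup>2" "(1 - c\<^sup>2) * (norm v)\<^sup>2 \<le> (norm (u + v))\<^sup>2"
proof -
  have "- Re (cinner u v) \<le> c * norm u * norm v"
    using assms abs_Re_le_cmod[of "cinner u v"] by linarith
  then have "(norm u)\<^sup>2 + (norm v)\<^sup>2 - 2 * (c * norm u * norm v) \<le> (norm (u + v))\<^sup>2"
    by (simp add: norm_add_sq)
  \<comment> \<open>The lower bound just found equals
    \<open>(1 - c\<^sup>2) * (norm u)\<^sup>2\<close> plus the first of these squares, and likewise
    with \<open>u\<close> and \<open>v\<close> exchanged for the second.\<close>
  moreover have "0 \<le> (norm v - c * norm u)\<^sup>2" "0 \<le> (norm u - c * norm v)\<^sup>2"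
    by simp_all
  ultimately show "(1 - c\<^sup>2) * (norm u)\<^sup>2 \<le> (norm (u + v))\<^sup>2" "(1 - c\<^sup>2) * (norm v)\<^sup>2 \<le> (norm (u + v))\<^sup>2"
    by (simp_all add: power2_diff power_mult_distrib algebra_simps)
qed

lemma norm_add_sq_orthogonal:
  fixes q w :: "'a::complex_inner"
  assumes "q \<in> Q" "w \<in> ortho_complement Q"
  shows "(norm (q + w))\<^sup>2 = (norm q)\<^sup>2 + (norm w)\<^sup>2"
  using assms norm_add_sq[of w q] by (simp add: ortho_complement_def add.commute)

text \<open>Since \<open>q\<close> is orthogonal to \<open>u + v\<close>, Pythagoras gives the bound
  on \<open>q\<close> and reduces the other two to the cosine bound for
  \<open>u + v\<close>.\<close>

lemma component_bounds:
  assumes "q \<in> L \<inter> M" and u: "u \<in> L \<ominus> (L \<inter> M)" and v: "v \<in> M \<ominus> (L \<inter> M)"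
    and c: "(inclination L M)\<^sup>2 < 1"
  shows "norm q \<le> norm (q + u + v)"
    and "norm u \<le> 1 / sqrt (1 - (inclination L M)\<^sup>2) * norm (q + u + v)"
    and "norm v \<le> 1 / sqrt (1 - (inclination L M)\<^sup>2) * norm (q + u + v)"
proof -
  define k where "k = 1 - (inclination L M)\<^sup>2"
  have k: "k > 0"
    using c by (simp add: k_def)
  have "u + v \<in> ortho_complement (L \<inter> M)"
    using u v by (auto simp: ominus_def intro: complex_space.subspace_add csubspace_ortho_complement)
  then have pyth: "(norm (q + u + v))\<^sup>2 = (norm q)\<^sup>2 + (norm (u + v))\<^sup>2"
    using norm_add_sq_orthogonal[OF assms(1)] by (simp add: add.assoc)
  then show "norm q \<le> norm (q + u + v)"
    by (metis le_add_same_cancel1 norm_ge_zero power2_le_imp_le zero_le_power2)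
  have *: "norm w \<le> 1 / sqrt k * norm (q + u + v)" if "k * (norm w)\<^sup>2 \<le> (norm (u + v))\<^sup>2" for w :: 'a
  proof -
    have "(sqrt k * norm w)\<^sup>2 \<le> (norm (q + u + v))\<^sup>2"
      unfolding pyth power_mult_distrib real_sqrt_pow2[OF less_imp_le[OF k]]
      using that zero_le_power2[of "norm q"] by linarith
    then have "sqrt k * norm w \<le> norm (q + u + v)"
      by (rule power2_le_imp_le) simp
    then show ?thesis
      using k by (simp add: field_simps)
  qed
  show "norm u \<le> 1 / sqrt (1 - (inclination L M)\<^sup>2) * norm (q + u + v)"
    "norm v \<le> 1 / sqrt (1 - (inclination L M)\<^sup>2) * norm (q + u + v)"
    using *[of u] *[of v] norm_add_sq_cosine_bound[OF cinner_le_inclination[OF u v]]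
    by (simp_all add: k_def)
qed

section \<open>Closedness and density of the sum\<close>

lemma sum_decomposition:
  fixes L M :: "'a::chilbert_space set"
  assumes "csubspace L" "closed L" "csubspace M" "closed M" "x \<in> L + M"
  obtains q u v where "q \<in> L \<inter> M" "u \<in> L \<ominus> (L \<inter> M)" "v \<in> M \<ominus> (L \<inter> M)" "x = q + u + v"
proof -
  have Q: "csubspace (L \<inter> M)" "closed (L \<inter> M)"
    using assms by (auto intro: complex_space.subspace_inter)
  obtain a b where ab: "a \<in> L" "b \<in> M" "x = a + b"
    using assms(5) by (rule set_plus_elim)
  obtain q u where "q \<in> L \<inter> M" "u \<in> L \<ominus> (L \<inter> M)" "a = q + u"
    using ominus_decomposition[OF assms(1) Q _ ab(1)] by blast
  moreover obtain q' v where "q' \<in> L \<inter> M" "v \<in> M \<ominus> (L \<inter> M)" "b = q' + v"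
    using ominus_decomposition[OF assms(3) Q _ ab(2)] by blast
  \<comment> \<open>Both summands contribute a component in \<open>L \<inter> M\<close>; the two
    merge into one.\<close>
  ultimately show thesis
    using that[of "q + q'" u v] complex_space.subspace_add[OF Q(1)] ab(3)
    by (simp add: algebra_simps)
qed

lemma closed_sum:
  fixes L M :: "'a::chilbert_space set"
  assumes L: "csubspace L" "closed L" and M: "csubspace M" "closed M"
    and c: "(inclination L M)\<^sup>2 < 1"
  shows "closed (L + M)"
  unfolding closed_sequential_limits
proof (intro allI impI, elim conjE)
  fix z :: "nat \<Rightarrow> 'a" and x
  assume zLM: "\<forall>n. z n \<in> L + M" and z: "z \<longlonglongrightarrow> x"
  define C where "C = 1 / sqrt (1 - (inclination L M)\<^sup>2)"
  have C: "C > 0"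
    using c by (simp add: C_def)
  have "\<exists>q u v. q \<in> L \<inter> M \<and> u \<in> L \<ominus> (L \<inter> M) \<and> v \<in> M \<ominus> (L \<inter> M) \<and> z n = q + u + v" for n
    using sum_decomposition[OF L M zLM[rule_format, of n]] by metis
  then obtain q u v where q: "\<And>n. q n \<in> L \<inter> M" and u: "\<And>n. u n \<in> L \<ominus> (L \<inter> M)"
    and v: "\<And>n. v n \<in> M \<ominus> (L \<inter> M)" and zn: "\<And>n. z n = q n + u n + v n"
    by metis
  have bound: "norm (v m - v n) \<le> C * norm (z m - z n)" for m n
  proof -
    \<comment> \<open>The differences decompose \<open>z m - z n\<close> in the same way, so the
      bound on the last component applies to them.\<close>
    have "q m - q n \<in> L \<inter> M" "u m - u n \<in> L \<ominus> (L \<inter> M)" "v m - v n \<in> M \<ominus> (L \<inter> M)"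
      using L(1) M(1) q u v
      by (blast intro: complex_space.subspace_diff csubspace_ominus complex_space.subspace_inter)+
    from component_bounds(3)[OF this c] show ?thesis
      by (simp add: zn C_def algebra_simps)
  qed
  have "Cauchy v"
  proof (rule CauchyI)
    fix e :: real assume "e > 0"
    then have "e / C > 0"
      using C by simp
    then obtain N where N: "\<forall>m\<ge>N. \<forall>n\<ge>N. norm (z m - z n) < e / C"
      using CauchyD[OF LIMSEQ_imp_Cauchy[OF z]] by blast
    then have "norm (v m - v n) < e" if "m \<ge> N" "n \<ge> N" for m n
      using le_less_trans[OF bound[of m n], of e] that C by (simp add: field_simps)
    then show "\<exists>N. \<forall>m\<ge>N. \<forall>n\<ge>N. norm (v m - v n) < e"
      by blast
  qed
  then obtain v0 where v0: "v \<longlonglongrightarrow> v0"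
    using Cauchy_convergent convergent_def by blast
  have vM: "v n \<in> M" for n
    using v by (simp add: ominus_def)
  have "v0 \<in> M"
    by (rule closed_sequentially[OF M(2) vM v0])
  \<comment> \<open>Only \<open>v\<close> needs its own limit: what remains of \<open>z\<close> lies
    in \<open>L\<close> and converges as a difference of convergent sequences.\<close>
  have zvL: "z n - v n \<in> L" for n
    using complex_space.subspace_add[OF L(1)] q[of n] u[of n] by (simp add: zn ominus_def)
  have "x - v0 \<in> L"
    by (rule closed_sequentially[OF L(2) zvL tendsto_diff[OF z v0]])
  then show "x \<in> L + M"
    using set_plus_intro[of "x - v0" L v0 M] \<open>v0 \<in> M\<close> by simp
qed

lemma csubspace_sum:
  assumes "csubspace L" "csubspace M"
  shows "csubspace (L + M)"
proof -
  have "L + M = {x + y | x y. x \<in> L \<and> y \<in> M}"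
    by (auto simp: set_plus_def)
  then show ?thesis
    using complex_space.subspace_sums[OF assms] by simp
qed

text \<open>The residual of projecting \<open>x\<close> onto \<open>S\<close> lies in the trivial
  complement, so \<open>x\<close> equals its projection.\<close>

lemma closed_csubspace_eq_UNIV:
  fixes S :: "'a::chilbert_space set"
  assumes "csubspace S" "closed S" "ortho_complement S = {0}"
  shows "S = UNIV"
proof -
  have "x \<in> S" for x
    using orthogonal_projection_exists[OF assms(1,2), of x] assms(3) by force
  then show ?thesis
    by blast
qed

theorem theorem1p1:
  fixes L M :: "'a::chilbert_space set"
  assumes "csubspace L" and "closed L"
    and "csubspace M" and "closed M"
    and "L \<ominus> (L \<inter> M) \<noteq> {0}" and "M \<ominus> (L \<inter> M) \<noteq> {0}"
    and "inclination L M < 1"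
    and "ortho_complement (L + M) = {0}"
  shows "\<exists>a1 a2 :: real. 0 \<le> a1 \<and> a1 \<le> 1 \<and> 0 \<le> a2 \<and> a2 \<le> 1 \<and>
    (L \<inter> M = {0} \<longrightarrow> a1 = 0 \<and> a2 = 0) \<and>
    (\<forall>x. \<exists>xL\<in>L. \<exists>xM\<in>M. x = xL + xM \<and>
      norm xL \<le> (a1 + 1 / sqrt (1 - (inclination L M)\<^sup>2)) * norm x \<and>
      norm xM \<le> (a2 + 1 / sqrt (1 - (inclination L M)\<^sup>2)) * norm x)"
proof -
  define C where "C = 1 / sqrt (1 - (inclination L M)\<^sup>2)"
  have c: "(inclination L M)\<^sup>2 < 1"
    using inclination_nonneg[OF assms(1,3,5,6)] assms(7) by (simp add: abs_square_less_1)
  have UNIV: "L + M = UNIV"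
    by (rule closed_csubspace_eq_UNIV[OF csubspace_sum[OF assms(1,3)] closed_sum[OF assms(1-4) c] assms(8)])
  \<comment> \<open>This coefficient pays for \<open>q\<close> in the bound on \<open>q + u\<close>:
    \<open>q\<close> vanishes when \<open>L \<inter> M\<close> is trivial, and otherwise its norm is
    at most \<open>norm x\<close>.\<close>
  define a :: real where "a = (if L \<inter> M = {0} then 0 else 1)"
  have "\<exists>xL\<in>L. \<exists>xM\<in>M. x = xL + xM \<and> norm xL \<le> (a + C) * norm x \<and> norm xM \<le> (0 + C) * norm x" for x
  proof -
    obtain q u v where quv: "q \<in> L \<inter> M" "u \<in> L \<ominus> (L \<inter> M)" "v \<in> M \<ominus> (L \<inter> M)"
      and x: "x = q + u + v"
      using sum_decomposition[OF assms(1-4), of x] UNIV by blast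
    note bounds = component_bounds[OF quv c, folded x C_def]
    have "norm q \<le> a * norm x"
      using quv(1) bounds(1) by (auto simp: a_def)
    then have "norm (q + u) \<le> (a + C) * norm x"
      using bounds(2) norm_triangle_ineq[of q u] by (simp add: distrib_right)
    moreover have "q + u \<in> L" "v \<in> M"
      using quv assms(1) by (auto simp: ominus_def intro: complex_space.subspace_add)
    ultimately show ?thesis
      using x bounds(3) by auto
  qed
  then show ?thesis
    unfolding C_def by (intro exI[of _ a] exI[of _ 0]) (auto simp: a_def)
qed

end
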